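(* Let $G$ be a finite graph and $n$ a positive integer. Let $A(n)$ be the algebra over $\mathbb{Z}$, free as a module on generators $x_1,\dots,x_n$, with multiplication $x_rx_t=0$ if $r\neq t$ and $x_r^2=x_r$. Let $H^k(G,A(n))$ be the color homology groups of $G$ with respect to $A(n)$. Then $H^{0}(G, A(n))$ is freely generated by the proper colorings of the graph $G$ with the $n$ colors $x_1,\dots,x_n$. Hence $\operatorname{rank}(H^{0}(G, A(n))) = C_{G}(n)$, the number of proper colorings of the nodes of $G$ with $n$ colors. The higher homology groups $H^{k}(G, A(n))$, $k\ge 1$, are zero.
   Context: $G$ is a finite graph. A coloring of the nodes of $G$ is proper if the two ends of every edge receive distinct colors (so a graph with a loop has no proper coloring). A subgraph $S$ of $G$ consists of all nodes of $G$ and a subset of its edges. Color complex: an enhancement $s$ of a subgraph $S$ is an assignment of a color from $\{x_1,\dots,x_n\}$ to each connected component of $S$. $C^k(G,A(n))$ is the free abelian group on all enhancements of subgraphs with exactly $k$ edges; in particular the generators of $C^0(G,A(n))$ are the assignments of colors to the nodes of $G$, and a proper coloring is regarded as such a generator. For an enhanced state $s$ over $S$ and an edge $e$ of $G$ not in $S$, define $\partial_e(s)$ as follows: if the ends of $e$ lie in the same component of $S$, colored $x$, then $\partial_e(s)$ is obtained by adding $e$ and keeping the color $x$ on that component; if the ends of $e$ lie in different components colored $x$ and $x'$, then $\partial_e(s)$ is obtained by adding $e$ and giving the merged component the product color $xx'$, with $\partial_e(s)=0$ if $xx'=0$; other components keep their colors. Fix an ordering of the edges of $G$ and set $d(s)=\sum_{e\in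 G-S}(-1)^{\pi(e,s)}\partial_e(s)$, the sum over edges of $G$ not in $S$, where $\pi(e,s)$ is the number of edges of $G-S$ preceding $e$ in the ordering. Then $d:C^k(G,A(n))\to C^{k+1}(G,A(n))$, $d\circ d=0$, and $H^k(G,A(n))$ is the kernel of $d$ on $C^k(G,A(n))$ modulo the image of $d$ from $C^{k-1}(G,A(n))$ (with $C^{-1}=0$). *)

theory Defs
  imports
    "HOL-Algebra.Algebra"
    "HOL-Library.Uprod"
    "HOL-Library.Extended_Nat"
begin

section \<open>Finite graphs and colorings\<close>

text \<open>Edges are named objects carrying an unordered pair of ends, so loops (\<open>Upair v v\<close>)
  and parallel edges are allowed.\<close>

record ('v, 'e) multigraph =
  nodes :: "'v set"
  edges :: "'e set"
  ends :: "'e \<Rightarrow> 'v uprod"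

definition finite_multigraph :: "('v, 'e) multigraph \<Rightarrow> bool" where
  "finite_multigraph G \<longleftrightarrow>
     finite (nodes G) \<and> finite (edges G) \<and> (\<forall>e\<in>edges G. set_uprod (ends G e) \<subseteq> nodes G)"

definition proper_colorings :: "('v, 'e) multigraph \<Rightarrow> nat \<Rightarrow> ('v \<Rightarrow> nat) set" where
  "proper_colorings G n =
     {f \<in> nodes G \<rightarrow>\<^sub>E {1..n}. \<forall>e\<in>edges G. \<forall>u v. ends G e = Upair u v \<longrightarrow> f u \<noteq> f v}"

definition chromatic_count :: "('v, 'e) multigraph \<Rightarrow> nat \<Rightarrow> nat" where
  "chromatic_count G n = card (proper_colorings G n)"

text \<open>Connected components of the spanning subgraph with edge set \<open>S\<close>, as sets of nodes.\<close>

definition connected_rel :: "('v, 'e) multigraph \<Rightarrow> 'e set \<Rightarrow> ('v \<times> 'v) set" where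
  "connected_rel G S =
     {(u, v). u \<in> nodes G \<and> v \<in> nodes G \<and> (u, v) \<in> {(x, y). \<exists>e\<in>S. ends G e = Upair x y}\<^sup>*}"

definition components :: "('v, 'e) multigraph \<Rightarrow> 'e set \<Rightarrow> 'v set set" where
  "components G S = nodes G // connected_rel G S"

definition component_of :: "('v, 'e) multigraph \<Rightarrow> 'e set \<Rightarrow> 'v \<Rightarrow> 'v set" where
  "component_of G S v = connected_rel G S `` {v}"


section \<open>The algebra \<open>A(n)\<close>\<close>

text \<open>The color \<open>x\<^sub>r\<close> is the index \<open>r \<in> {1..n}\<close>; as an element of the algebra it is
  \<open>frag_of r\<close>. The product is the bilinear extension of the multiplication table.\<close>

definition color_algebra :: "nat \<Rightarrow> (nat \<Rightarrow>\<^sub>0 int) ring" where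
  "color_algebra n =
     \<lparr>carrier = carrier (free_Abelian_group {1..n}),
      monoid.mult = (\<lambda>a b. frag_extend (\<lambda>r. frag_extend (\<lambda>t. if r = t then frag_of r else 0) b) a),
      monoid.one = (\<Sum>r = 1..n. frag_of r),
      ring.zero = 0,
      ring.add = (+)\<rparr>"

lemma color_algebra_mult_generators:
  "frag_of r \<otimes>\<^bsub>color_algebra n\<^esub> frag_of t = (if r = t then frag_of r else 0)"
  by (simp add: color_algebra_def)


section \<open>The color complex\<close>

type_synonym ('v, 'e) estate = "'e set \<times> ('v set \<Rightarrow> nat)"

definition enhancements :: "('v, 'e) multigraph \<Rightarrow> nat \<Rightarrow> nat \<Rightarrow> ('v, 'e) estate set" where
  "enhancements G n k =
     {(S, c). S \<subseteq> edges G \<and> card S = k \<and> c \<in> components G S \<rightarrow>\<^sub>E {1..n}}"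

definition chain_group :: "('v, 'e) multigraph \<Rightarrow> nat \<Rightarrow> nat \<Rightarrow> (('v, 'e) estate \<Rightarrow>\<^sub>0 int) monoid" where
  "chain_group G n k = free_Abelian_group (enhancements G n k)"

text \<open>A coloring of the nodes, viewed as an enhancement of the subgraph without edges,
  whose components are the singletons \<open>{v}\<close>.\<close>

definition coloring_state :: "('v, 'e) multigraph \<Rightarrow> ('v \<Rightarrow> nat) \<Rightarrow> ('v, 'e) estate" where
  "coloring_state G f = ({}, restrict (\<lambda>K. f (the_elem K)) (components G {}))"

text \<open>The enhancement obtained by adding \<open>e\<close> to \<open>S\<close> and giving the component \<open>M\<close> of the
  result the color \<open>r\<close>.\<close>

definition add_edge ::
  "('v, 'e) multigraph \<Rightarrow> 'e \<Rightarrow> 'e set \<Rightarrow> ('v set \<Rightarrow> nat) \<Rightarrow> 'v set \<Rightarrow> nat \<Rightarrow> ('v, 'e) estate" where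
  "add_edge G e S c M r = (insert e S, restrict (c(M := r)) (components G (insert e S)))"

text \<open>The ends of \<open>e\<close> are listed in an arbitrary order \<open>u, v\<close>, which does not affect the result.
  The product of two colors lies in \<open>A(n)\<close>; an enhancement with the value \<open>\<Sum>\<^sub>r a\<^sub>r x\<^sub>r\<close> on the
  merged component is read as \<open>\<Sum>\<^sub>r a\<^sub>r\<close> times the enhancement with color \<open>x\<^sub>r\<close> there. As the
  product of two colors is a color or zero, this is a single enhancement or zero
  (\<open>partial_edge_cases\<close> below).\<close>

definition partial_edge ::
  "('v, 'e) multigraph \<Rightarrow> nat \<Rightarrow> 'e \<Rightarrow> ('v, 'e) estate \<Rightarrow> ('v, 'e) estate \<Rightarrow>\<^sub>0 int" where
  "partial_edge G n e s =
     (let (S, c) = s;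
          (u, v) = (SOME p. ends G e = Upair (fst p) (snd p));
          K = component_of G S u;
          L = component_of G S v
      in if K = L then frag_of (add_edge G e S c K (c K))
         else frag_extend (\<lambda>r. frag_of (add_edge G e S c (K \<union> L) r))
                (frag_of (c K) \<otimes>\<^bsub>color_algebra n\<^esub> frag_of (c L)))"

lemma partial_edge_cases:
  fixes S :: "'e set"
  assumes "ends G e = Upair u v"
  defines "K \<equiv> component_of G S u" and "L \<equiv> component_of G S v"
  shows "partial_edge G n e (S, c) =
           (if c K = c L then frag_of (add_edge G e S c (K \<union> L) (c K)) else 0)"
proof -
  obtain u' v' where p: "(SOME p. ends G e = Upair (fst p) (snd p)) = (u', v')"
    by fastforce
  have "\<exists>p. ends G e = Upair (fst p) (snd p)"
    using assms(1) by auto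
  from someI_ex[OF this] have "ends G e = Upair u' v'"
    using p by simp
  then have uv: "u' = u \<and> v' = v \<or> u' = v \<and> v' = u"
    using assms(1) by auto
  have "partial_edge G n e (S, c) =
          (let K' = component_of G S u'; L' = component_of G S v'
           in if c K' = c L' then frag_of (add_edge G e S c (K' \<union> L') (c K')) else 0)"
    unfolding partial_edge_def p Let_def prod.case color_algebra_mult_generators by simp
  then show ?thesis
    using uv unfolding K_def L_def Let_def by (elim disjE conjE) (simp_all add: Un_commute)
qed

text \<open>The ordering of the edges is a reflexive linear order \<open>ord\<close>; hence the condition
  \<open>f \<noteq> e\<close> in the count of the edges preceding \<open>e\<close>.\<close>

definition sign_exponent :: "('v, 'e) multigraph \<Rightarrow> ('e \<times> 'e) set \<Rightarrow> 'e \<Rightarrow> 'e set \<Rightarrow> nat" where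
  "sign_exponent G ord e S = card {f \<in> edges G - S. f \<noteq> e \<and> (f, e) \<in> ord}"

definition differential ::
  "('v, 'e) multigraph \<Rightarrow> ('e \<times> 'e) set \<Rightarrow> nat \<Rightarrow> (('v, 'e) estate \<Rightarrow>\<^sub>0 int) \<Rightarrow> ('v, 'e) estate \<Rightarrow>\<^sub>0 int" where
  "differential G ord n =
     frag_extend (\<lambda>s. \<Sum>e\<in>edges G - fst s.
       frag_cmul ((-1) ^ sign_exponent G ord e (fst s)) (partial_edge G n e s))"

definition color_cycles ::
  "('v, 'e) multigraph \<Rightarrow> ('e \<times> 'e) set \<Rightarrow> nat \<Rightarrow> nat \<Rightarrow> (('v, 'e) estate \<Rightarrow>\<^sub>0 int) set" where
  "color_cycles G ord n k =
     kernel (chain_group G n k) (chain_group G n (Suc k)) (differential G ord n)"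

definition color_boundaries ::
  "('v, 'e) multigraph \<Rightarrow> ('e \<times> 'e) set \<Rightarrow> nat \<Rightarrow> nat \<Rightarrow> (('v, 'e) estate \<Rightarrow>\<^sub>0 int) set" where
  "color_boundaries G ord n k =
     (case k of 0 \<Rightarrow> {0} | Suc j \<Rightarrow> differential G ord n ` carrier (chain_group G n j))"

definition color_cycle_group ::
  "('v, 'e) multigraph \<Rightarrow> ('e \<times> 'e) set \<Rightarrow> nat \<Rightarrow> nat \<Rightarrow> (('v, 'e) estate \<Rightarrow>\<^sub>0 int) monoid" where
  "color_cycle_group G ord n k = subgroup_generated (chain_group G n k) (color_cycles G ord n k)"

definition color_homology ::
  "('v, 'e) multigraph \<Rightarrow> ('e \<times> 'e) set \<Rightarrow> nat \<Rightarrow> nat \<Rightarrow> (('v, 'e) estate \<Rightarrow>\<^sub>0 int) set monoid" where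
  "color_homology G ord n k = color_cycle_group G ord n k Mod color_boundaries G ord n k"

definition homology_class ::
  "('v, 'e) multigraph \<Rightarrow> ('e \<times> 'e) set \<Rightarrow> nat \<Rightarrow> nat \<Rightarrow> (('v, 'e) estate \<Rightarrow>\<^sub>0 int)
     \<Rightarrow> (('v, 'e) estate \<Rightarrow>\<^sub>0 int) set" where
  "homology_class G ord n k z = color_boundaries G ord n k #>\<^bsub>color_cycle_group G ord n k\<^esub> z"


section \<open>Free generation and rank of abelian groups\<close>

text \<open>The indexed family \<open>(g i)\<^sub>i\<^sub>\<in>\<^sub>I\<close> freely generates \<open>H\<close>.\<close>

definition freely_generated_by :: "('a, 'b) monoid_scheme \<Rightarrow> 'i set \<Rightarrow> ('i \<Rightarrow> 'a) \<Rightarrow> bool" where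
  "freely_generated_by H I g \<longleftrightarrow>
     (\<exists>\<phi> \<in> iso (free_Abelian_group I) H. \<forall>i\<in>I. \<phi> (frag_of i) = g i)"

definition int_independent :: "('a, 'b) monoid_scheme \<Rightarrow> 'a set \<Rightarrow> bool" where
  "int_independent H B \<longleftrightarrow> finite B \<and> B \<subseteq> carrier H \<and>
     (\<forall>m :: 'a \<Rightarrow> int. finprod H (\<lambda>b. b [^]\<^bsub>H\<^esub> m b) B = \<one>\<^bsub>H\<^esub> \<longrightarrow> (\<forall>b\<in>B. m b = 0))"

definition abelian_rank :: "('a, 'b) monoid_scheme \<Rightarrow> enat" where
  "abelian_rank H = (SUP B \<in> {B. int_independent H B}. enat (card B))"

end

theory Submission
  imports Defs
begin

text \<open>An enhancement of a subgraph \<open>S\<close> is the same as a coloring \<open>f\<close> of the nodes under which every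
  edge of \<open>S\<close> is monochromatic (\<open>enhancements_eq_colored_states\<close>). In these terms \<open>\<partial>\<^sub>e\<close> keeps \<open>f\<close>;
  it adds \<open>e\<close> to \<open>S\<close> if \<open>e\<close> is monochromatic for \<open>f\<close>, and is zero otherwise, because \<open>x\<^sub>r x\<^sub>t = 0\<close> for
  \<open>r \<noteq> t\<close> and \<open>x\<^sub>r\<^sup>2 = x\<^sub>r\<close> (\<open>differential_colored_state\<close>). Hence the color complex is the direct sum,
  over all node colorings \<open>f\<close>, of the signed complexes of subsets of \<open>mono_edges G f\<close>.

  If \<open>f\<close> is proper, its summand is a copy of the integers in degree zero. Otherwise fix a
  monochromatic edge; removing this edge, with the appropriate sign, is a contracting homotopy of the
  summand (\<open>contraction_homotopy_colored_state\<close>). The only property of the signs that matters is that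
  adding two edges in the two possible orders gives opposite signs (\<open>sign_exponent_swap\<close>); it also
  yields \<open>d \<circ> d = 0\<close>. So the cycles of degree zero are the combinations of proper colorings
  (\<open>color_cycles_0\<close>), and in every positive degree cycles are boundaries (\<open>color_cycles_Suc\<close>).

  The rank of a group with finitely many free generators is their number
  (\<open>abelian_rank_freely_generated\<close>).\<close>

section \<open>Enhancements as node colorings\<close>

text \<open>The edges whose two ends receive the same color under \<open>f\<close>; a loop always belongs to this set.\<close>

definition mono_edges :: "('v, 'e) multigraph \<Rightarrow> ('v \<Rightarrow> nat) \<Rightarrow> 'e set" where
  "mono_edges G f = {e \<in> edges G. \<exists>u v. ends G e = Upair u v \<and> f u = f v}"

text \<open>The enhancement of \<open>S\<close> that gives each component the common color of its nodes under \<open>f\<close>.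
  It is meaningful only for \<open>S \<subseteq> mono_edges G f\<close>, where \<open>f\<close> takes one value on each component.\<close>

definition colored_state ::
  "('v, 'e) multigraph \<Rightarrow> 'e set \<Rightarrow> ('v \<Rightarrow> nat) \<Rightarrow> ('v, 'e) estate" where
  "colored_state G S f = (S, restrict (\<lambda>K. the_elem (f ` K)) (components G S))"

text \<open>The converse translation: every node receives the color of its component.\<close>

definition node_coloring :: "('v, 'e) multigraph \<Rightarrow> ('v, 'e) estate \<Rightarrow> 'v \<Rightarrow> nat" where
  "node_coloring G s = restrict (\<lambda>v. snd s (component_of G (fst s) v)) (nodes G)"

lemma proper_colorings_iff_mono_edges:
  "f \<in> proper_colorings G n \<longleftrightarrow> f \<in> nodes G \<rightarrow>\<^sub>E {1..n} \<and> mono_edges G f = {}"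
  unfolding proper_colorings_def mono_edges_def by blast

lemma mono_edges_subset: "mono_edges G f \<subseteq> edges G"
  by (auto simp: mono_edges_def)

lemma equiv_connected_rel: "equiv (nodes G) (connected_rel G S)"
proof -
  define R where "R = {(x, y). \<exists>e\<in>S. ends G e = Upair x y}"
  have "sym R"
    unfolding R_def
  proof (intro symI, clarsimp)
    fix x y e assume "e \<in> S" "ends G e = Upair x y"
    moreover have "Upair x y = Upair y x" by simp
    ultimately show "\<exists>e\<in>S. ends G e = Upair y x" by metis
  qed
  then have "sym (R\<^sup>*)" by (rule sym_rtrancl)
  then show ?thesis
    unfolding connected_rel_def R_def[symmetric]
    by (intro equivI) (auto simp: refl_on_def sym_def trans_def intro: rtrancl_trans)
qed

lemma component_of_self: "v \<in> nodes G \<Longrightarrow> v \<in> component_of G S v"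
  using equiv_class_self[OF equiv_connected_rel] unfolding component_of_def by fast

lemma component_of_eq:
  "w \<in> component_of G S v \<Longrightarrow> component_of G S w = component_of G S v"
  unfolding component_of_def using equiv_class_eq[OF equiv_connected_rel] by fastforce

lemma component_of_in_components: "v \<in> nodes G \<Longrightarrow> component_of G S v \<in> components G S"
  unfolding component_of_def components_def by (rule quotientI)

lemma components_cases:
  assumes "K \<in> components G S"
  obtains v where "v \<in> nodes G" "K = component_of G S v"
  using assms unfolding component_of_def components_def by (auto elim: quotientE)

lemma mono_edges_ends:
  "e \<in> mono_edges G f \<Longrightarrow> ends G e = Upair u v \<Longrightarrow> f u = f v"
  by (auto simp: mono_edges_def)

lemma constant_on_component:
  assumes "S \<subseteq> mono_edges G f" and w: "w \<in> component_of G S v"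
  shows "f w = f v"
proof -
  have "(v, w) \<in> {(x, y). \<exists>e\<in>S. ends G e = Upair x y}\<^sup>*"
    using w by (auto simp: component_of_def connected_rel_def)
  then show ?thesis
  proof (induction rule: rtrancl_induct)
    case (step y z)
    then obtain e where "e \<in> S" "ends G e = Upair y z" by blast
    then have "f y = f z" using assms(1) mono_edges_ends[of e G f y z] by blast
    with step.IH show ?case by simp
  qed simp
qed

lemma the_elem_component:
  assumes "S \<subseteq> mono_edges G f" "v \<in> nodes G"
  shows "the_elem (f ` component_of G S v) = f v"
proof -
  have "f ` component_of G S v = {f v}"
    using constant_on_component[OF assms(1)] component_of_self[OF assms(2)]
    by (intro equalityI subsetI) auto
  then show ?thesis by simp
qed

lemma colored_state_component:
  assumes "S \<subseteq> mono_edges G f" "v \<in> nodes G"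
  shows "snd (colored_state G S f) (component_of G S v) = f v"
  using assms by (simp add: colored_state_def component_of_in_components the_elem_component)

lemma node_coloring_colored_state:
  assumes "S \<subseteq> mono_edges G f" "f \<in> extensional (nodes G)"
  shows "node_coloring G (colored_state G S f) = f"
proof
  fix v
  show "node_coloring G (colored_state G S f) v = f v"
    using assms colored_state_component[OF assms(1), of v]
    by (cases "v \<in> nodes G") (auto simp: node_coloring_def colored_state_def extensional_def)
qed

lemma component_of_edge:
  assumes "e \<in> S" "ends G e = Upair u v" "u \<in> nodes G" "v \<in> nodes G"
  shows "v \<in> component_of G S u"
  using assms by (auto simp: component_of_def connected_rel_def)

text \<open>This is the change of generators on which everything rests: an enhanced state is a node
  coloring together with a set of its monochromatic edges.\<close>

lemma enhancements_eq_colored_states: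
  assumes G: "finite_multigraph G"
  shows "enhancements G n k =
    {colored_state G S f | S f. S \<subseteq> mono_edges G f \<and> card S = k \<and> f \<in> nodes G \<rightarrow>\<^sub>E {1..n}}"
    (is "?L = ?R")
proof (intro equalityI subsetI)
  fix s assume "s \<in> ?L"
  then obtain S c where s: "s = (S, c)" and S: "S \<subseteq> edges G" "card S = k"
    and c: "c \<in> components G S \<rightarrow>\<^sub>E {1..n}"
    unfolding enhancements_def by blast
  define f where "f = node_coloring G s"
  have f: "f v = c (component_of G S v)" if "v \<in> nodes G" for v
    using that by (simp add: f_def node_coloring_def s)
  have "f \<in> nodes G \<rightarrow>\<^sub>E {1..n}"
    using c component_of_in_components unfolding f_def node_coloring_def s by fastforce
  moreover have Sf: "S \<subseteq> mono_edges G f"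
  proof
    fix e assume e: "e \<in> S"
    obtain u v where uv: "ends G e = Upair u v" by (cases "ends G e")
    have uvG: "u \<in> nodes G" "v \<in> nodes G"
      using G S(1) e uv unfolding finite_multigraph_def by fastforce+
    have "f u = f v"
      using component_of_eq[OF component_of_edge[OF e uv uvG]] f uvG by simp
    then show "e \<in> mono_edges G f"
      using S(1) e uv unfolding mono_edges_def by blast
  qed
  moreover have "s = colored_state G S f"
  proof -
    have "c K = restrict (\<lambda>K. the_elem (f ` K)) (components G S) K" for K
    proof (cases "K \<in> components G S")
      case True
      then obtain v where v: "v \<in> nodes G" "K = component_of G S v" by (rule components_cases)
      then show ?thesis using True f the_elem_component[OF Sf] by simp
    next
      case False
      then show ?thesis using PiE_arb[OF c] by simp
    qed
    then show ?thesis by (auto simp: s colored_state_def)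
  qed
  ultimately show "s \<in> ?R" using S by blast
next
  fix s assume "s \<in> ?R"
  then obtain S f where s: "s = colored_state G S f" and S: "S \<subseteq> mono_edges G f" "card S = k"
    and f: "f \<in> nodes G \<rightarrow>\<^sub>E {1..n}" by blast
  have "snd s K \<in> {1..n}" if K: "K \<in> components G S" for K
    using K
  proof (rule components_cases)
    fix v assume "v \<in> nodes G" "K = component_of G S v"
    then show ?thesis using colored_state_component[OF S(1)] f s by (metis PiE_mem)
  qed
  then show "s \<in> ?L"
    using S mono_edges_subset[of G f] unfolding s colored_state_def enhancements_def by auto
qed

lemma coloring_state_eq_colored_state: "coloring_state G f = colored_state G {} f"
proof -
  have "K = {the_elem K}" if "K \<in> components G {}" for K
  proof -
    obtain v where v: "v \<in> nodes G" "K = component_of G {} v"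
      using \<open>K \<in> components G {}\<close> by (rule components_cases)
    then have "K = {v}" by (auto simp: component_of_def connected_rel_def)
    then show ?thesis by simp
  qed
  then have "the_elem (f ` K) = f (the_elem K)" if "K \<in> components G {}" for K
    using that by (metis image_empty image_insert the_elem_eq)
  then show ?thesis
    unfolding coloring_state_def colored_state_def by (auto simp: restrict_def)
qed

text \<open>Adding an edge merges the components of its ends and leaves the others alone.\<close>

lemma component_of_insert:
  assumes G: "finite_multigraph G" and S: "insert e S \<subseteq> edges G"
    and e: "ends G e = Upair u v" and w: "w \<in> nodes G"
  shows "component_of G (insert e S) w =
    (let M = component_of G S u \<union> component_of G S v in
     if w \<in> M then M else component_of G S w)"
proof -
  have ends_nodes: "x \<in> nodes G \<and> y \<in> nodes G"
    if "e' \<in> insert e S" "ends G e' = Upair x y" for e' x y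
    using G S that unfolding finite_multigraph_def by fastforce
  then have uv: "u \<in> nodes G" "v \<in> nodes G"
    using e by blast+
  define M where "M = component_of G S u \<union> component_of G S v"
  have mono: "component_of G S x \<subseteq> component_of G (insert e S) x" for x
  proof -
    have "{(x, y). \<exists>e\<in>S. ends G e = Upair x y}\<^sup>* \<subseteq> {(x, y). \<exists>e\<in>insert e S. ends G e = Upair x y}\<^sup>*"
      by (rule rtrancl_mono) blast
    then show ?thesis
      unfolding component_of_def connected_rel_def by blast
  qed
  have M: "M \<subseteq> component_of G (insert e S) x" if "x \<in> M" for x
  proof -
    have "component_of G (insert e S) v = component_of G (insert e S) u"
      by (intro component_of_eq component_of_edge[OF _ e uv]) auto
    then have "M \<subseteq> component_of G (insert e S) u"
      using mono unfolding M_def by blast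
    moreover have "component_of G (insert e S) x = component_of G (insert e S) u"
      using \<open>M \<subseteq> component_of G (insert e S) u\<close> that by (intro component_of_eq) blast
    ultimately show ?thesis by simp
  qed
  define Q where "Q = (if w \<in> M then M else component_of G S w)"
  \<comment> \<open>Walk from \<open>w\<close>: an old edge stays within an old component, and the new edge is met only
    from inside \<open>M\<close>, which forces \<open>w \<in> M\<close>.\<close>
  have M_closed: "component_of G S y \<subseteq> M" if "y \<in> M" for y
    using that component_of_eq[of y G S u] component_of_eq[of y G S v] unfolding M_def by blast
  have w_M: "w \<in> M" if "y \<in> M" "y \<in> component_of G S w" for y
    using M_closed[OF that(1)] component_of_eq[OF that(2)] component_of_self[OF w] by blast
  have "x \<in> Q" if "(w, x) \<in> {(x, y). \<exists>e\<in>insert e S. ends G e = Upair x y}\<^sup>*" for x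
    using that
  proof (induction rule: rtrancl_induct)
    case base
    show ?case using component_of_self[OF w] by (simp add: Q_def)
  next
    case (step y x)
    then obtain e' where e': "e' \<in> insert e S" "ends G e' = Upair y x" by blast
    then have yx: "y \<in> nodes G" "x \<in> nodes G" using ends_nodes by blast+
    show ?case
    proof (cases "e' \<in> S")
      case True
      then have "x \<in> component_of G S y"
        using component_of_edge e'(2) yx by fast
      moreover have "component_of G S y \<subseteq> Q"
        using step.IH M_closed component_of_eq[of y G S w] unfolding Q_def by (auto split: if_splits)
      ultimately show ?thesis by blast
    next
      case False
      then have "y \<in> M" "x \<in> M"
        using e e' component_of_self[OF uv(1)] component_of_self[OF uv(2)] unfolding M_def by auto
      then show ?thesis
        using step.IH w_M unfolding Q_def by (auto split: if_splits)
    qed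
  qed
  then have "component_of G (insert e S) w \<subseteq> Q"
    by (auto simp: component_of_def connected_rel_def)
  moreover have "Q \<subseteq> component_of G (insert e S) w"
    using M mono unfolding Q_def by auto
  ultimately show ?thesis unfolding Q_def M_def Let_def by blast
qed

section \<open>The differential and the contracting homotopy on colorings\<close>

text \<open>The map \<open>\<partial>\<^sub>e\<close> never changes the node coloring: two components of different colors have
  product zero, and merging components of the same color keeps that color.\<close>

lemma partial_edge_colored_state:
  assumes G: "finite_multigraph G" and S: "S \<subseteq> mono_edges G f" and e: "e \<in> edges G"
  shows "partial_edge G n e (colored_state G S f) =
    (if e \<in> mono_edges G f then frag_of (colored_state G (insert e S) f) else 0)"
proof -
  obtain u v where uv: "ends G e = Upair u v" by (cases "ends G e")
  have uvG: "u \<in> nodes G" "v \<in> nodes G"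
    using G e uv unfolding finite_multigraph_def by fastforce+
  define c where "c = snd (colored_state G S f)"
  define M where "M = component_of G S u \<union> component_of G S v"
  have st: "colored_state G S f = (S, c)"
    by (simp add: c_def colored_state_def)
  have c: "c (component_of G S w) = f w" if "w \<in> nodes G" for w
    using colored_state_component[OF S that] by (simp add: c_def)
  have mono: "e \<in> mono_edges G f \<longleftrightarrow> f u = f v"
    using e uv by (auto simp: mono_edges_def)
  have "add_edge G e S c M (f u) = colored_state G (insert e S) f" if fuv: "f u = f v"
  proof -
    have eS: "insert e S \<subseteq> mono_edges G f"
      using S mono fuv by simp
    have "(c(M := f u)) K = the_elem (f ` K)" if "K \<in> components G (insert e S)" for K
      using that
    proof (rule components_cases)
      fix w assume w: "w \<in> nodes G" "K = component_of G (insert e S) w"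
      have comp: "K = (if w \<in> M then M else component_of G S w)"
        using component_of_insert[OF G _ uv w(1), of S] eS mono_edges_subset[of G f]
        unfolding w(2) M_def Let_def by blast
      have K: "the_elem (f ` K) = f w"
        unfolding w(2) by (rule the_elem_component[OF eS w(1)])
      show ?thesis
      proof (cases "w \<in> M")
        case True
        then have "f w = f u"
          using constant_on_component[OF S] fuv unfolding M_def by auto
        then show ?thesis using True comp K by simp
      next
        case False
        then have "K = component_of G S w" "K \<noteq> M"
          using comp component_of_self[OF w(1), of S] by auto
        then show ?thesis using c[OF w(1)] K by simp
      qed
    qed
    then show ?thesis
      unfolding add_edge_def colored_state_def by (auto simp: restrict_def)
  qed
  then show ?thesis
    unfolding st partial_edge_cases[OF uv] c[OF uvG(1)] c[OF uvG(2)] mono M_def by simp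
qed

lemma differential_colored_state:
  assumes G: "finite_multigraph G" and S: "S \<subseteq> mono_edges G f"
  shows "differential G ord n (frag_of (colored_state G S f)) =
    (\<Sum>e\<in>mono_edges G f - S.
       frag_cmul ((-1) ^ sign_exponent G ord e S) (frag_of (colored_state G (insert e S) f)))"
proof -
  have "differential G ord n (frag_of (colored_state G S f)) =
    (\<Sum>e\<in>edges G - S. frag_cmul ((-1) ^ sign_exponent G ord e S)
      (if e \<in> mono_edges G f then frag_of (colored_state G (insert e S) f) else 0))"
    unfolding differential_def frag_extend_of
    using partial_edge_colored_state[OF G S]
    by (intro sum.cong) (auto simp: colored_state_def)
  also have "\<dots> = (\<Sum>e\<in>mono_edges G f - S.
       frag_cmul ((-1) ^ sign_exponent G ord e S) (frag_of (colored_state G (insert e S) f)))"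
    using G mono_edges_subset[of G f]
    by (intro sum.mono_neutral_cong_right) (auto simp: finite_multigraph_def)
  finally show ?thesis .
qed

text \<open>Adding two edges in the two possible orders produces opposite signs.\<close>

lemma sign_exponent_swap:
  assumes G: "finite_multigraph G" and ord: "linear_order_on (edges G) ord"
    and e: "e \<in> edges G - S" "e' \<in> edges G - S" "e \<noteq> e'"
  shows "(-1 :: int) ^ sign_exponent G ord e S * (-1) ^ sign_exponent G ord e' (insert e S) =
    - ((-1) ^ sign_exponent G ord e' S * (-1) ^ sign_exponent G ord e (insert e' S))"
proof -
  have fin: "finite (edges G)" using G by (simp add: finite_multigraph_def)
  have anti: "antisym ord" and tot: "total_on (edges G) ord"
    using ord by (auto simp: linear_order_on_def partial_order_on_def)
  have less: "sign_exponent G ord b S = Suc (sign_exponent G ord b (insert a S))"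
    "sign_exponent G ord a (insert b S) = sign_exponent G ord a S"
    if "a \<in> edges G - S" "a \<noteq> b" "(a, b) \<in> ord" for a b
  proof -
    have "{f \<in> edges G - S. f \<noteq> b \<and> (f, b) \<in> ord} =
      insert a {f \<in> edges G - insert a S. f \<noteq> b \<and> (f, b) \<in> ord}"
      using that by auto
    then show "sign_exponent G ord b S = Suc (sign_exponent G ord b (insert a S))"
      using fin unfolding sign_exponent_def by simp
    have "{f \<in> edges G - insert b S. f \<noteq> a \<and> (f, a) \<in> ord} =
      {f \<in> edges G - S. f \<noteq> a \<and> (f, a) \<in> ord}"
      using that anti unfolding antisym_def by blast
    then show "sign_exponent G ord a (insert b S) = sign_exponent G ord a S"
      unfolding sign_exponent_def by simp
  qed
  have "(e, e') \<in> ord \<or> (e', e) \<in> ord"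
    using tot e unfolding total_on_def by blast
  then show ?thesis
    using less[of e e'] less[of e' e] e by auto
qed

lemma sum_antisymmetric_eq_0:
  fixes g :: "'a \<Rightarrow> 'a \<Rightarrow> 'b \<Rightarrow>\<^sub>0 int"
  assumes "\<And>x y. x \<in> A \<Longrightarrow> y \<in> A \<Longrightarrow> g x y = - g y x"
  shows "(\<Sum>x\<in>A. \<Sum>y\<in>A. g x y) = 0"
proof -
  let ?X = "\<Sum>x\<in>A. \<Sum>y\<in>A. g x y"
  have "?X = (\<Sum>x\<in>A. \<Sum>y\<in>A. - g y x)"
    by (intro sum.cong refl assms)
  also have "\<dots> = - ?X"
    by (subst sum.swap) (simp add: sum_negf)
  finally have "?X = - ?X" .
  from arg_cong[OF this, of "\<lambda>z. Poly_Mapping.lookup z i" for i]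
  have "Poly_Mapping.lookup ?X i = - Poly_Mapping.lookup ?X i" for i
    unfolding lookup_uminus .
  then have "Poly_Mapping.lookup ?X i = 0" for i
    by (metis equal_neg_zero)
  then show ?thesis by (intro poly_mapping_eqI) simp
qed

lemma differential_squared_colored_state:
  assumes G: "finite_multigraph G" and ord: "linear_order_on (edges G) ord"
    and S: "S \<subseteq> mono_edges G f"
  shows "differential G ord n (differential G ord n (frag_of (colored_state G S f))) = 0"
proof -
  define sg where "sg e T = (-1 :: int) ^ sign_exponent G ord e T" for e T
  define A where "A = mono_edges G f - S"
  have fin: "finite A"
    using G finite_subset[OF mono_edges_subset] unfolding A_def finite_multigraph_def by auto
  define g where "g e e' = (if e = e' then 0 else
    frag_cmul (sg e S * sg e' (insert e S)) (frag_of (colored_state G (insert e' (insert e S)) f)))"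
    for e e'
  have "differential G ord n (differential G ord n (frag_of (colored_state G S f))) =
    (\<Sum>e\<in>A. frag_cmul (sg e S) (differential G ord n (frag_of (colored_state G (insert e S) f))))"
    unfolding differential_colored_state[OF G S]
    unfolding differential_def using fin
    unfolding A_def[symmetric] sg_def[symmetric]
    by (simp add: frag_extend_sum frag_extend_cmul o_def)
  also have "\<dots> = (\<Sum>e\<in>A. \<Sum>e'\<in>A. g e e')"
  proof (intro sum.cong refl)
    fix e assume e: "e \<in> A"
    then have eS: "insert e S \<subseteq> mono_edges G f" using S by (auto simp: A_def)
    have "frag_cmul (sg e S) (differential G ord n (frag_of (colored_state G (insert e S) f))) =
      (\<Sum>e'\<in>mono_edges G f - insert e S. frag_cmul (sg e S * sg e' (insert e S))
         (frag_of (colored_state G (insert e' (insert e S)) f)))"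
      unfolding differential_colored_state[OF G eS] by (simp add: frag_cmul_sum sg_def)
    also have "\<dots> = (\<Sum>e'\<in>A. g e e')"
      using fin by (intro sum.mono_neutral_cong_left) (auto simp: A_def g_def)
    finally show "frag_cmul (sg e S) (differential G ord n (frag_of (colored_state G (insert e S) f)))
      = (\<Sum>e'\<in>A. g e e')" .
  qed
  also have "\<dots> = 0"
  proof (rule sum_antisymmetric_eq_0)
    fix e e' assume "e \<in> A" "e' \<in> A"
    then have "sg e S * sg e' (insert e S) = - (sg e' S * sg e (insert e' S))" if "e \<noteq> e'"
      using sign_exponent_swap[OF G ord _ _ that, of S] mono_edges_subset[of G f]
      unfolding A_def sg_def by auto
    then show "g e e' = - g e' e"
      unfolding g_def by (auto simp: insert_commute)
  qed
  finally show ?thesis .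
qed

text \<open>A monochromatic edge of \<open>f\<close>, chosen once for each \<open>f\<close>; unspecified if there is none,
  that is, if \<open>f\<close> is proper.\<close>

definition contracted_edge :: "('v, 'e) multigraph \<Rightarrow> ('v \<Rightarrow> nat) \<Rightarrow> 'e" where
  "contracted_edge G f = (SOME e. e \<in> mono_edges G f)"

text \<open>The contracting homotopy. It removes the chosen edge, with the sign with which the
  differential would add it again, and sends a state not containing that edge to zero.\<close>

definition contraction ::
  "('v, 'e) multigraph \<Rightarrow> ('e \<times> 'e) set \<Rightarrow> (('v, 'e) estate \<Rightarrow>\<^sub>0 int) \<Rightarrow> ('v, 'e) estate \<Rightarrow>\<^sub>0 int" where
  "contraction G ord = frag_extend (\<lambda>s.
     let S = fst s; f = node_coloring G s; e = contracted_edge G f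
     in if e \<in> S then frag_cmul ((-1) ^ sign_exponent G ord e (S - {e}))
          (frag_of (colored_state G (S - {e}) f)) else 0)"

lemma contraction_colored_state:
  assumes "S \<subseteq> mono_edges G f" "f \<in> extensional (nodes G)"
  defines "e \<equiv> contracted_edge G f"
  shows "contraction G ord (frag_of (colored_state G S f)) =
    (if e \<in> S then frag_cmul ((-1) ^ sign_exponent G ord e (S - {e}))
       (frag_of (colored_state G (S - {e}) f)) else 0)"
  unfolding contraction_def frag_extend_of node_coloring_colored_state[OF assms(1,2)] Let_def e_def
  by (simp add: colored_state_def)

lemma contraction_homotopy_colored_state:
  assumes G: "finite_multigraph G" and ord: "linear_order_on (edges G) ord"
    and S: "S \<subseteq> mono_edges G f" and f: "f \<in> extensional (nodes G)"
    and ne: "mono_edges G f \<noteq> {}"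
  shows "differential G ord n (contraction G ord (frag_of (colored_state G S f)))
    + contraction G ord (differential G ord n (frag_of (colored_state G S f)))
    = frag_of (colored_state G S f)"
proof -
  define M where "M = mono_edges G f"
  define sg where "sg e T = (-1 :: int) ^ sign_exponent G ord e T" for e T
  define x where "x T = frag_of (colored_state G T f)" for T
  define a where "a = contracted_edge G f"
  have a: "a \<in> M"
    using ne unfolding a_def M_def contracted_edge_def by (simp add: some_in_eq)
  have fin: "finite M"
    using G finite_subset[OF mono_edges_subset] unfolding M_def finite_multigraph_def by auto
  have D: "differential G ord n (x T) = (\<Sum>e\<in>M - T. frag_cmul (sg e T) (x (insert e T)))"
    if "T \<subseteq> M" for T
    using differential_colored_state[OF G, of T f ord n] that unfolding x_def M_def sg_def by simp
  have H: "contraction G ord (x T) = (if a \<in> T then frag_cmul (sg a (T - {a})) (x (T - {a})) else 0)"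
    if "T \<subseteq> M" for T
    using contraction_colored_state[of T G f ord] that f unfolding x_def M_def sg_def a_def by simp
  have sq: "sg e T * sg e T = 1" for e T
    by (simp add: sg_def flip: power_add mult_2)
  have HD: "contraction G ord (differential G ord n (x S)) =
    (\<Sum>e\<in>M - S. frag_cmul (sg e S) (contraction G ord (x (insert e S))))"
    unfolding D[OF S[folded M_def]] unfolding contraction_def using fin
    by (simp add: frag_extend_sum frag_extend_cmul o_def)
  have "differential G ord n (contraction G ord (x S))
    + contraction G ord (differential G ord n (x S)) = x S"
  proof (cases "a \<in> S")
    case False
    \<comment> \<open>Only the summand of the differential that adds \<open>a\<close> survives the contraction.\<close>
    have "contraction G ord (differential G ord n (x S)) =
      (\<Sum>e\<in>M - S. if e = a then x S else 0)"
      unfolding HD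
    proof (intro sum.cong refl)
      fix e assume "e \<in> M - S"
      then show "frag_cmul (sg e S) (contraction G ord (x (insert e S))) = (if e = a then x S else 0)"
        using H[of "insert e S"] S False sq unfolding M_def by (auto simp: insert_Diff_if)
    qed
    also have "\<dots> = x S" using fin a False by simp
    finally show ?thesis
      using H[of S] S False unfolding M_def by (simp add: differential_def)
  next
    case True
    define T where "T = S - {a}"
    have ST: "S = insert a T" "a \<notin> T" using True by (auto simp: T_def)
    have TM: "T \<subseteq> M" using S unfolding T_def M_def by blast
    \<comment> \<open>Here adding \<open>a\<close> back to \<open>T\<close> gives \<open>x S\<close>, and all other terms cancel against those of the
      contraction of the differential.\<close>
    have DH: "differential G ord n (contraction G ord (x S)) =
      x S + (\<Sum>e\<in>M - S. frag_cmul (sg a T * sg e T) (x (insert e T)))"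
    proof -
      have "differential G ord n (contraction G ord (x S)) =
        frag_cmul (sg a T) (differential G ord n (x T))"
        using H[of S] S True unfolding M_def T_def by (simp add: differential_def frag_extend_cmul)
      also have "\<dots> = (\<Sum>e\<in>M - T. frag_cmul (sg a T * sg e T) (x (insert e T)))"
        unfolding D[OF TM] by (simp add: frag_cmul_sum)
      also have "M - T = insert a (M - S)" using a ST by auto
      also have "(\<Sum>e\<in>insert a (M - S). frag_cmul (sg a T * sg e T) (x (insert e T))) =
        x S + (\<Sum>e\<in>M - S. frag_cmul (sg a T * sg e T) (x (insert e T)))"
        using fin True by (simp add: sq ST(1))
      finally show ?thesis .
    qed
    have "contraction G ord (differential G ord n (x S)) =
      (\<Sum>e\<in>M - S. - frag_cmul (sg a T * sg e T) (x (insert e T)))"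
      unfolding HD
    proof (intro sum.cong refl)
      fix e assume e: "e \<in> M - S"
      then have ea: "e \<noteq> a" "e \<notin> T" using True ST by auto
      have ins: "insert e S - {a} = insert e T" using ea by (auto simp: T_def)
      have "sg e T * sg a (insert e T) = - (sg a T * sg e S)"
        using sign_exponent_swap[OF G ord, of e T a] e a ea ST mono_edges_subset[of G f]
        unfolding sg_def M_def by auto
      \<comment> \<open>Multiply by \<open>sg e T * sg e S\<close> and use that signs square to one.\<close>
      then have "sg e T * (sg e T * sg a (insert e T)) * sg e S = - (sg e T * (sg a T * sg e S)) * sg e S"
        by simp
      then have "sg e S * sg a (insert e T) = - (sg a T * sg e T)"
        using sq[of e T] sq[of e S] by (simp add: algebra_simps) (metis mult.assoc mult.commute mult_1)
      then show "frag_cmul (sg e S) (contraction G ord (x (insert e S))) =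
        - frag_cmul (sg a T * sg e T) (x (insert e T))"
        using H[of "insert e S"] e S True ins unfolding M_def by simp
    qed
    then show ?thesis by (simp add: DH sum_negf del: minus_frag_cmul)
  qed
  then show ?thesis by (simp add: x_def)
qed

section \<open>Rank of free abelian groups, and quotients\<close>

text \<open>More integer vectors than coordinates are linearly dependent over the integers. Induction on
  the number of coordinates, eliminating one coordinate by cross-multiplication with a pivot.\<close>

lemma int_linear_dependence:
  fixes a :: "'b \<Rightarrow> 'i \<Rightarrow> int"
  assumes "finite I" "finite B" "card I < card B"
  obtains m :: "'b \<Rightarrow> int" and b where "b \<in> B" "m b \<noteq> 0" "\<And>i. i \<in> I \<Longrightarrow> (\<Sum>b\<in>B. m b * a b i) = 0"
proof -
  have "\<exists>m. (\<exists>b\<in>B. m b \<noteq> 0) \<and> (\<forall>i\<in>I. (\<Sum>b\<in>B. m b * a b i) = 0)"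
    using assms
  proof (induction I arbitrary: B a rule: finite_induct)
    case empty
    then obtain b where "b \<in> B" by fastforce
    then show ?case by (intro exI[of _ "\<lambda>_. 1"]) auto
  next
    case (insert i I)
    show ?case
    proof (cases "\<forall>b\<in>B. a b i = 0")
      case True
      have "card I < card B" using insert by simp
      then obtain m where "\<exists>b\<in>B. m b \<noteq> 0" "\<forall>i\<in>I. (\<Sum>b\<in>B. m b * a b i) = 0"
        using insert.IH[of B a] insert.prems(1) by blast
      with True show ?thesis by (intro exI[of _ m]) auto
    next
      case False
      then obtain b0 where b0: "b0 \<in> B" "a b0 i \<noteq> 0" by blast
      define a' where "a' b j = a b0 i * a b j - a b i * a b0 j" for b j
      have card: "card I < card (B - {b0})"
        using insert b0 by simp
      obtain m' b where m': "b \<in> B - {b0}" "m' b \<noteq> 0"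
        "\<And>j. j \<in> I \<Longrightarrow> (\<Sum>b\<in>B - {b0}. m' b * a' b j) = 0"
        using insert.IH[OF _ card, of a'] insert.prems by blast
      \<comment> \<open>The coefficients of the relation between the \<open>a' b\<close>, expanded in terms of the \<open>a b\<close>.\<close>
      define m where "m b = (if b = b0 then - (\<Sum>b\<in>B - {b0}. m' b * a b i) else a b0 i * m' b)" for b
      have eq: "(\<Sum>b\<in>B. m b * a b j) = (\<Sum>b\<in>B - {b0}. m' b * a' b j)" for j
      proof -
        have "(\<Sum>b\<in>B. m b * a b j) = m b0 * a b0 j + (\<Sum>b\<in>B - {b0}. m b * a b j)"
          using insert.prems b0 by (simp add: sum.remove)
        also have "(\<Sum>b\<in>B - {b0}. m b * a b j) = (\<Sum>b\<in>B - {b0}. a b0 i * m' b * a b j)"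
          by (intro sum.cong) (auto simp: m_def)
        also have "m b0 * a b0 j = (\<Sum>b\<in>B - {b0}. - (m' b * a b i * a b0 j))"
          by (simp add: m_def sum_distrib_right sum_negf)
        finally show ?thesis
          by (simp add: a'_def algebra_simps sum_subtractf sum_negf)
      qed
      have "(\<Sum>b\<in>B. m b * a b j) = 0" if "j \<in> insert i I" for j
        using that m'(3) unfolding eq by (auto simp: a'_def)
      moreover have "m b \<noteq> 0" using m' b0 by (auto simp: m_def)
      ultimately show ?thesis using m'(1) by blast
    qed
  qed
  then show ?thesis using that by blast
qed

lemma finprod_int_pow_hom:
  assumes H: "comm_group H" and \<phi>: "\<phi> \<in> hom (free_Abelian_group I) H"
    and "finite B" and "\<And>b. b \<in> B \<Longrightarrow> Poly_Mapping.keys (a b) \<subseteq> I \<and> \<phi> (a b) = b"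
  shows "finprod H (\<lambda>b. b [^]\<^bsub>H\<^esub> m b) B = \<phi> (\<Sum>b\<in>B. frag_cmul (m b) (a b))"
proof -
  interpret H: comm_group H by fact
  interpret \<phi>: group_hom "free_Abelian_group I" H \<phi>
    using \<phi> by (intro group_hom.intro) (auto simp: group_hom_axioms_def)
  show ?thesis
    using assms(3,4)
  proof (induction B rule: finite_induct)
    case empty
    show ?case using \<phi>.hom_one by simp
  next
    case (insert b B)
    have closed: "c \<in> carrier H" if "c \<in> insert b B" for c
      using insert.prems[OF that] \<phi>.hom_closed[of "a c"] by auto
    have keys: "Poly_Mapping.keys (frag_cmul (m c) (a c)) \<subseteq> I" if "c \<in> insert b B" for c
      using insert.prems[OF that] keys_cmul by fast
    have "\<phi> (frag_cmul (m b) (a b)) = b [^]\<^bsub>H\<^esub> m b"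
      using \<phi>.hom_int_pow[of "a b" "m b"] insert.prems[of b] by simp
    moreover have "Poly_Mapping.keys (\<Sum>b\<in>B. frag_cmul (m b) (a b)) \<subseteq> I"
      using keys_sum[of "\<lambda>b. frag_cmul (m b) (a b)" B] keys by blast
    ultimately show ?case
      using insert closed keys[of b] \<phi>.hom_mult[of "frag_cmul (m b) (a b)" "\<Sum>b\<in>B. frag_cmul (m b) (a b)"]
      by (simp add: H.finprod_insert Pi_iff)
  qed
qed

text \<open>The supremum defining the rank is attained at the free generators; the upper bound is
  \<open>int_linear_dependence\<close> applied to coordinate vectors.\<close>

lemma abelian_rank_freely_generated:
  assumes H: "comm_group H" and free: "freely_generated_by H I g" and I: "finite I"
  shows "abelian_rank H = enat (card I)"
proof -
  interpret H: comm_group H by fact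
  obtain \<phi> where \<phi>: "\<phi> \<in> iso (free_Abelian_group I) H" and \<phi>g: "\<And>i. i \<in> I \<Longrightarrow> \<phi> (frag_of i) = g i"
    using free unfolding freely_generated_by_def by blast
  have hom: "\<phi> \<in> hom (free_Abelian_group I) H"
    and bij: "bij_betw \<phi> (carrier (free_Abelian_group I)) (carrier H)"
    using \<phi> by (auto simp: iso_def)
  have one: "\<phi> 0 = \<one>\<^bsub>H\<^esub>"
    using hom_one[OF hom group_free_Abelian_group H.is_group] by simp
  have "card B \<le> card I" if B: "int_independent H B" for B
  proof (rule ccontr)
    assume "\<not> card B \<le> card I"
    define a where "a = inv_into (carrier (free_Abelian_group I)) \<phi>"
    have a: "Poly_Mapping.keys (a b) \<subseteq> I \<and> \<phi> (a b) = b" if "b \<in> B" for b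
    proof -
      have "b \<in> \<phi> ` carrier (free_Abelian_group I)"
        using that B bij by (auto simp: int_independent_def bij_betw_def)
      from inv_into_into[OF this] f_inv_into_f[OF this] show ?thesis
        unfolding a_def by simp
    qed
    have "finite B" using B by (simp add: int_independent_def)
    obtain m b where m: "b \<in> B" "m b \<noteq> 0"
      "\<And>i. i \<in> I \<Longrightarrow> (\<Sum>b\<in>B. m b * Poly_Mapping.lookup (a b) i) = 0"
      using int_linear_dependence[OF I \<open>finite B\<close>, of "\<lambda>b. Poly_Mapping.lookup (a b)"]
        \<open>\<not> card B \<le> card I\<close> by (metis not_le)
    have "(\<Sum>b\<in>B. frag_cmul (m b) (a b)) = 0"
    proof (rule poly_mapping_eqI)
      fix i
      have "(\<Sum>b\<in>B. m b * Poly_Mapping.lookup (a b) i) = 0"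
      proof (cases "i \<in> I")
        case False
        then have "Poly_Mapping.lookup (a b) i = 0" if "b \<in> B" for b
          using a[OF that] by (meson not_in_keys_iff_lookup_eq_zero subsetD)
        then show ?thesis by simp
      qed (rule m)
      then show "Poly_Mapping.lookup (\<Sum>b\<in>B. frag_cmul (m b) (a b)) i = Poly_Mapping.lookup 0 i"
        by (simp add: lookup_sum)
    qed
    then have "finprod H (\<lambda>b. b [^]\<^bsub>H\<^esub> m b) B = \<one>\<^bsub>H\<^esub>"
      using finprod_int_pow_hom[OF H hom \<open>finite B\<close> a, of m] one by simp
    then show False using B m by (auto simp: int_independent_def)
  qed
  moreover have "int_independent H (g ` I)" "card (g ` I) = card I"
  proof -
    have inj: "inj_on g I"
    proof (rule inj_onI)
      fix i j assume ij: "i \<in> I" "j \<in> I" "g i = g j"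
      then have "frag_of i = frag_of j"
        using bij \<phi>g inj_onD[of \<phi> "carrier (free_Abelian_group I)" "frag_of i" "frag_of j"]
        by (simp add: bij_betw_def)
      then show "i = j" by (simp add: frag_of_eq)
    qed
    then show "card (g ` I) = card I" by (rule card_image)
    define a where "a b = frag_of (inv_into I g b)" for b
    have a: "Poly_Mapping.keys (a b) \<subseteq> I \<and> \<phi> (a b) = b" if "b \<in> g ` I" for b
      using that \<phi>g inj by (auto simp: a_def)
    have "m b = 0" if m: "finprod H (\<lambda>b. b [^]\<^bsub>H\<^esub> m b) (g ` I) = \<one>\<^bsub>H\<^esub>" and b: "b \<in> g ` I"
      for m :: "_ \<Rightarrow> int" and b
    proof -
      let ?s = "\<Sum>b\<in>g ` I. frag_cmul (m b) (a b)"
      have s: "?s = (\<Sum>i\<in>I. frag_cmul (m (g i)) (frag_of i))"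
        by (subst sum.reindex[OF inj]) (auto simp: a_def inj intro: sum.cong)
      have "Poly_Mapping.keys ?s \<subseteq> I"
      proof (rule order_trans[OF keys_sum UN_least])
        fix b assume "b \<in> g ` I"
        then show "Poly_Mapping.keys (frag_cmul (m b) (a b)) \<subseteq> I"
          using a order_trans[OF keys_cmul] by blast
      qed
      moreover have "\<phi> ?s = \<phi> 0"
        using finprod_int_pow_hom[OF H hom _ a, of "g ` I" m] I m one by simp
      ultimately have "?s = 0"
        using bij inj_onD[of \<phi> "carrier (free_Abelian_group I)" ?s 0] by (simp add: bij_betw_def)
      then have *: "Poly_Mapping.lookup (\<Sum>i\<in>I. frag_cmul (m (g i)) (frag_of i)) j = 0" for j
        unfolding s by simp
      obtain i where i: "i \<in> I" "b = g i" using b by blast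
      have "(\<Sum>k\<in>I. m (g k) * (if i = k then 1 else 0)) = 0"
        using *[of i] by (simp add: lookup_sum)
      then show ?thesis using i I by (simp add: if_distrib cong: if_cong)
    qed
    then show "int_independent H (g ` I)"
      using I a hom_in_carrier[OF hom] \<phi>g unfolding int_independent_def
      by (metis (no_types, lifting) carrier_free_Abelian_group_iff finite_imageI subsetI)
  qed
  ultimately show ?thesis
    unfolding abelian_rank_def
    by (intro antisym SUP_least) (auto intro: SUP_upper2[of "g ` I"])
qed

lemma iso_free_Abelian_group_image:
  assumes "inj_on g I"
  shows "frag_extend (frag_of \<circ> g) \<in> iso (free_Abelian_group I) (free_Abelian_group (g ` I))"
proof -
  let ?F = "frag_extend (frag_of \<circ> g)" and ?G = "frag_extend (frag_of \<circ> inv_into I g)"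
  have keysF: "Poly_Mapping.keys (?F c) \<subseteq> g ` I" if "Poly_Mapping.keys c \<subseteq> I" for c
    using keys_frag_extend[of "frag_of \<circ> g" c] that by auto
  have keysG: "Poly_Mapping.keys (?G c) \<subseteq> I" if "Poly_Mapping.keys c \<subseteq> g ` I" for c
    using keys_frag_extend[of "frag_of \<circ> inv_into I g" c] that inv_into_into[of _ g I] by fastforce
  have GF: "?G (?F c) = c" if "Poly_Mapping.keys c \<subseteq> I" for c
  proof -
    have "?G (?F c) = frag_extend frag_of c"
      unfolding frag_extend_compose using that assms by (intro frag_extend_eq) auto
    then show ?thesis using frag_expansion by metis
  qed
  have FG: "?F (?G c) = c" if "Poly_Mapping.keys c \<subseteq> g ` I" for c
  proof -
    have "?F (?G c) = frag_extend frag_of c"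
      unfolding frag_extend_compose using that f_inv_into_f[of _ g I] by (intro frag_extend_eq) auto
    then show ?thesis using frag_expansion by metis
  qed
  have "bij_betw ?F (carrier (free_Abelian_group I)) (carrier (free_Abelian_group (g ` I)))"
    by (rule bij_betwI[where g = ?G]) (use keysF keysG GF FG in \<open>auto simp del: o_apply\<close>)
  moreover have "?F \<in> hom (free_Abelian_group I) (free_Abelian_group (g ` I))"
    using keysF by (intro homI) (auto simp: frag_extend_add)
  ultimately show ?thesis by (rule isoI[rotated])
qed

lemma r_coset_trivial_iso:
  assumes "group Z"
  shows "(\<lambda>z. {\<one>\<^bsub>Z\<^esub>} #>\<^bsub>Z\<^esub> z) \<in> iso Z (Z Mod {\<one>\<^bsub>Z\<^esub>})"
proof (rule isoI)
  interpret Z: group Z by fact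
  show "(\<lambda>z. {\<one>\<^bsub>Z\<^esub>} #>\<^bsub>Z\<^esub> z) \<in> hom Z (Z Mod {\<one>\<^bsub>Z\<^esub>})"
    by (rule normal.r_coset_hom_Mod[OF Z.one_is_normal])
  have "inj_on (\<lambda>z. {\<one>\<^bsub>Z\<^esub>} #>\<^bsub>Z\<^esub> z) (carrier Z)"
    by (rule inj_onI) (simp add: r_coset_def)
  then show "bij_betw (\<lambda>z. {\<one>\<^bsub>Z\<^esub>} #>\<^bsub>Z\<^esub> z) (carrier Z) (carrier (Z Mod {\<one>\<^bsub>Z\<^esub>}))"
    by (simp add: bij_betw_def carrier_FactGroup)
qed

lemma trivial_group_Mod_carrier:
  assumes "comm_group Z"
  shows "trivial_group (Z Mod carrier Z)"
proof -
  interpret Z: comm_group Z by fact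
  have "carrier (Z Mod carrier Z) \<subseteq> {carrier Z}"
    using Z.coset_join2[OF _ Z.subgroup_self] by (auto simp: carrier_FactGroup)
  then show ?thesis
    using comm_group.axioms(2)[OF Z.abelian_FactGroup[OF Z.subgroup_self]]
    by (simp add: group.trivial_group_subset)
qed

section \<open>Cycles, boundaries and homology\<close>

lemma differential_contraction_linear:
  "differential G ord n 0 = 0" "contraction G ord 0 = 0"
  "differential G ord n (a - b) = differential G ord n a - differential G ord n b"
  "contraction G ord (a - b) = contraction G ord a - contraction G ord b"
  by (simp_all add: differential_def contraction_def frag_extend_diff)

lemma keys_differential:
  assumes G: "finite_multigraph G" and z: "Poly_Mapping.keys z \<subseteq> enhancements G n k"
  shows "Poly_Mapping.keys (differential G ord n z) \<subseteq> enhancements G n (Suc k)"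
  using z
proof (induction z rule: frag_induction)
  case zero
  show ?case by (simp add: differential_contraction_linear)
next
  case (diff a b)
  then show ?case using keys_diff unfolding differential_contraction_linear by fast
next
  case (one s)
  then obtain S f where s: "s = colored_state G S f" and S: "S \<subseteq> mono_edges G f" "card S = k"
    and f: "f \<in> nodes G \<rightarrow>\<^sub>E {1..n}"
    unfolding enhancements_eq_colored_states[OF G] by blast
  have "finite S"
    using G finite_subset[OF S(1)] finite_subset[OF mono_edges_subset]
    unfolding finite_multigraph_def by blast
  then have "colored_state G (insert e S) f \<in> enhancements G n (Suc k)" if "e \<in> mono_edges G f - S" for e
    using that S f unfolding enhancements_eq_colored_states[OF G] by force
  then show ?case
    unfolding s differential_colored_state[OF G S(1)]
    by (intro order_trans[OF keys_sum]) (auto split: if_splits)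
qed

lemma keys_contraction:
  assumes G: "finite_multigraph G" and z: "Poly_Mapping.keys z \<subseteq> enhancements G n (Suc k)"
  shows "Poly_Mapping.keys (contraction G ord z) \<subseteq> enhancements G n k"
  using z
proof (induction z rule: frag_induction)
  case zero
  show ?case by (simp add: differential_contraction_linear)
next
  case (diff a b)
  then show ?case using keys_diff unfolding differential_contraction_linear by fast
next
  case (one s)
  then obtain S f where s: "s = colored_state G S f" and S: "S \<subseteq> mono_edges G f" "card S = Suc k"
    and f: "f \<in> nodes G \<rightarrow>\<^sub>E {1..n}"
    unfolding enhancements_eq_colored_states[OF G] by blast
  have "colored_state G (S - {e}) f \<in> enhancements G n k" if "e \<in> S" for e
    using that S f unfolding enhancements_eq_colored_states[OF G]
    by (auto intro!: exI[of _ "S - {e}"] exI[of _ f])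
  moreover have "f \<in> extensional (nodes G)" using f by (simp add: PiE_def)
  ultimately show ?case
    unfolding s contraction_colored_state[OF S(1) \<open>f \<in> extensional (nodes G)\<close>]
    by (simp split: if_splits) (intro impI subset_trans[OF keys_cmul], simp)
qed

lemma differential_squared:
  assumes G: "finite_multigraph G" and ord: "linear_order_on (edges G) ord"
    and z: "Poly_Mapping.keys z \<subseteq> enhancements G n k"
  shows "differential G ord n (differential G ord n z) = 0"
  using z
proof (induction z rule: frag_induction)
  case (one s)
  then show ?case
    unfolding enhancements_eq_colored_states[OF G]
    using differential_squared_colored_state[OF G ord] by blast
qed (simp_all add: differential_contraction_linear)

lemma contraction_homotopy:
  assumes G: "finite_multigraph G" and ord: "linear_order_on (edges G) ord"
    and z: "Poly_Mapping.keys z \<subseteq> enhancements G n (Suc k)"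
  shows "differential G ord n (contraction G ord z) + contraction G ord (differential G ord n z) = z"
  using z
proof (induction z rule: frag_induction)
  case (one s)
  then obtain S f where s: "s = colored_state G S f" and S: "S \<subseteq> mono_edges G f" "card S = Suc k"
    and f: "f \<in> nodes G \<rightarrow>\<^sub>E {1..n}"
    unfolding enhancements_eq_colored_states[OF G] by blast
  have "mono_edges G f \<noteq> {}" using S by auto
  then show ?case
    using contraction_homotopy_colored_state[OF G ord S(1)] f unfolding s by (simp add: PiE_def)
next
  case (diff a b)
  then show ?case unfolding differential_contraction_linear by (simp add: algebra_simps)
qed (simp add: differential_contraction_linear)

text \<open>In degree zero the homotopy formula has an extra term, the projection onto the span of the
  proper colorings.\<close>

lemma keys_cycle_0:
  assumes G: "finite_multigraph G" and ord: "linear_order_on (edges G) ord"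
    and z: "Poly_Mapping.keys z \<subseteq> enhancements G n 0" and dz: "differential G ord n z = 0"
  shows "Poly_Mapping.keys z \<subseteq> coloring_state G ` proper_colorings G n"
proof -
  \<comment> \<open>On generators, \<open>p\<close> is that projection.\<close>
  define p where "p s = (if s \<in> coloring_state G ` proper_colorings G n then frag_of s else 0)" for s
  have "frag_extend p z + contraction G ord (differential G ord n z) = z"
    using z
  proof (induction z rule: frag_induction)
    case (one s)
    then obtain S f where s: "s = colored_state G S f" and S: "S \<subseteq> mono_edges G f" "card S = 0"
      and f: "f \<in> nodes G \<rightarrow>\<^sub>E {1..n}"
      unfolding enhancements_eq_colored_states[OF G] by blast
    have "finite S"
      using G finite_subset[OF S(1)] finite_subset[OF mono_edges_subset]
      unfolding finite_multigraph_def by blast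
    then have s0: "s = coloring_state G f" "S = {}"
      using S s by (auto simp: coloring_state_eq_colored_state)
    have fext: "f \<in> extensional (nodes G)" using f by (simp add: PiE_def)
    show ?case
    proof (cases "mono_edges G f = {}")
      case True
      then have "p s = frag_of s"
        using f by (simp add: p_def s0 proper_colorings_iff_mono_edges)
      moreover have "differential G ord n (frag_of s) = 0"
        unfolding s differential_colored_state[OF G S(1)] by (simp add: True)
      ultimately show ?thesis by (simp add: differential_contraction_linear)
    next
      case False
      have "s \<noteq> coloring_state G f'" if f': "f' \<in> proper_colorings G n" for f'
      proof
        assume "s = coloring_state G f'"
        moreover have "f' \<in> extensional (nodes G)"
          using f' by (simp add: proper_colorings_iff_mono_edges PiE_def)
        ultimately have "f' = f"
          using node_coloring_colored_state[OF empty_subsetI] fext s0(1)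
          unfolding coloring_state_eq_colored_state by metis
        then show False using False f' by (simp add: proper_colorings_iff_mono_edges)
      qed
      then have "p s = 0" by (auto simp: p_def)
      then show ?thesis
        using contraction_homotopy_colored_state[OF G ord S(1) fext False]
          contraction_colored_state[OF S(1) fext, of ord] s s0(2) by (simp add: differential_contraction_linear)
    qed
  next
    case (diff a b)
    then show ?case unfolding differential_contraction_linear by (simp add: algebra_simps frag_extend_diff)
  qed (simp add: differential_contraction_linear)
  then have "z = frag_extend p z" using dz by (simp add: differential_contraction_linear)
  moreover have "Poly_Mapping.keys (frag_extend p z) \<subseteq> coloring_state G ` proper_colorings G n"
    by (rule order_trans[OF keys_frag_extend]) (auto simp: p_def split: if_splits)
  ultimately show ?thesis by simp
qed

lemma color_cycles_iff:
  "z \<in> color_cycles G ord n k \<longleftrightarrow>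
    Poly_Mapping.keys z \<subseteq> enhancements G n k \<and> differential G ord n z = 0"
  by (simp add: color_cycles_def kernel_def chain_group_def)

lemma color_cycles_0:
  assumes G: "finite_multigraph G" and ord: "linear_order_on (edges G) ord"
  shows "color_cycles G ord n 0 =
    carrier (free_Abelian_group (coloring_state G ` proper_colorings G n))"
proof (intro equalityI subsetI)
  fix z assume "z \<in> color_cycles G ord n 0"
  then show "z \<in> carrier (free_Abelian_group (coloring_state G ` proper_colorings G n))"
    using keys_cycle_0[OF G ord] by (simp add: color_cycles_iff)
next
  fix z assume "z \<in> carrier (free_Abelian_group (coloring_state G ` proper_colorings G n))"
  then have "Poly_Mapping.keys z \<subseteq> coloring_state G ` proper_colorings G n" by simp
  then show "z \<in> color_cycles G ord n 0"
  proof (induction z rule: frag_induction)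
    case (one s)
    then obtain f where s: "s = colored_state G {} f" and f: "f \<in> nodes G \<rightarrow>\<^sub>E {1..n}" "mono_edges G f = {}"
      by (auto simp: coloring_state_eq_colored_state proper_colorings_iff_mono_edges)
    have "differential G ord n (frag_of s) = 0"
      unfolding s differential_colored_state[OF G empty_subsetI] by (simp add: f)
    moreover have "s \<in> enhancements G n 0"
      unfolding enhancements_eq_colored_states[OF G] using s f
      by (auto intro!: exI[of _ "{}"] exI[of _ f])
    ultimately show ?case by (simp add: color_cycles_iff)
  next
    case (diff a b)
    then show ?case using keys_diff[of a b] by (auto simp: color_cycles_iff differential_contraction_linear)
  qed (simp add: color_cycles_iff differential_contraction_linear)
qed

lemma color_cycles_Suc:
  assumes G: "finite_multigraph G" and ord: "linear_order_on (edges G) ord"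
  shows "color_cycles G ord n (Suc k) = color_boundaries G ord n (Suc k)"
proof (intro equalityI subsetI)
  fix z assume "z \<in> color_cycles G ord n (Suc k)"
  then have z: "Poly_Mapping.keys z \<subseteq> enhancements G n (Suc k)" "differential G ord n z = 0"
    by (auto simp: color_cycles_iff)
  then have "z = differential G ord n (contraction G ord z)"
    using contraction_homotopy[OF G ord z(1)] by (simp add: differential_contraction_linear)
  then show "z \<in> color_boundaries G ord n (Suc k)"
    using keys_contraction[OF G z(1), of ord] by (auto simp: color_boundaries_def chain_group_def)
next
  fix z assume "z \<in> color_boundaries G ord n (Suc k)"
  then obtain y where "z = differential G ord n y" "Poly_Mapping.keys y \<subseteq> enhancements G n k"
    by (auto simp: color_boundaries_def chain_group_def)
  then show "z \<in> color_cycles G ord n (Suc k)"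
    using keys_differential[OF G] differential_squared[OF G ord] by (simp add: color_cycles_iff)
qed

lemma comm_group_color_cycle_group: "comm_group (color_cycle_group G ord n k)"
  unfolding color_cycle_group_def chain_group_def
  by (intro group.abelian_subgroup_generated) (simp_all add: abelian_free_Abelian_group)

lemma carrier_color_cycle_group:
  assumes G: "finite_multigraph G"
  shows "carrier (color_cycle_group G ord n k) = color_cycles G ord n k"
proof -
  have "differential G ord n \<in> hom (chain_group G n k) (chain_group G n (Suc k))"
    using keys_differential[OF G]
    by (intro homI) (auto simp: chain_group_def differential_def frag_extend_add)
  then have "group_hom (chain_group G n k) (chain_group G n (Suc k)) (differential G ord n)"
    by (intro group_hom.intro) (simp_all add: group_hom_axioms_def chain_group_def)
  then have "subgroup (color_cycles G ord n k) (chain_group G n k)"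
    unfolding color_cycles_def by (rule group_hom.subgroup_kernel)
  then show ?thesis
    unfolding color_cycle_group_def by (rule subgroup.carrier_subgroup_generated_subgroup)
qed

lemma color_homology_0_freely_generated:
  assumes G: "finite_multigraph G" and ord: "linear_order_on (edges G) ord"
  shows "freely_generated_by (color_homology G ord n 0) (proper_colorings G n)
    (\<lambda>f. homology_class G ord n 0 (frag_of (coloring_state G f)))"
proof -
  let ?P = "proper_colorings G n" and ?Z = "color_cycle_group G ord n 0"
  have one: "\<one>\<^bsub>?Z\<^esub> = 0" by (simp add: color_cycle_group_def chain_group_def)
  have B: "color_boundaries G ord n 0 = {\<one>\<^bsub>?Z\<^esub>}"
    unfolding one by (simp add: color_boundaries_def)
  have "inj_on (coloring_state G) ?P"
  proof (rule inj_onI)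
    fix f g assume "f \<in> ?P" "g \<in> ?P" "coloring_state G f = coloring_state G g"
    moreover from this have "f \<in> extensional (nodes G)" "g \<in> extensional (nodes G)"
      by (simp_all add: proper_colorings_iff_mono_edges PiE_def)
    ultimately show "f = g"
      using node_coloring_colored_state[OF empty_subsetI]
      unfolding coloring_state_eq_colored_state by metis
  qed
  then have "frag_extend (frag_of \<circ> coloring_state G)
    \<in> iso (free_Abelian_group ?P) (free_Abelian_group (coloring_state G ` ?P))"
    by (rule iso_free_Abelian_group_image)
  then have "frag_extend (frag_of \<circ> coloring_state G) \<in> iso (free_Abelian_group ?P) ?Z"
    unfolding iso_def hom_def carrier_color_cycle_group[OF G] color_cycles_0[OF G ord]
    by (simp add: color_cycle_group_def chain_group_def)
  from iso_set_trans[OF this r_coset_trivial_iso]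
  have "(\<lambda>z. {\<one>\<^bsub>?Z\<^esub>} #>\<^bsub>?Z\<^esub> z) \<circ> frag_extend (frag_of \<circ> coloring_state G)
    \<in> iso (free_Abelian_group ?P) (color_homology G ord n 0)"
    using comm_group_color_cycle_group[of G ord n 0]
    unfolding color_homology_def B by (simp add: comm_group.axioms(2))
  then show ?thesis
    unfolding freely_generated_by_def
    by (rule bexI[rotated]) (simp add: homology_class_def B)
qed

theorem mainTheorem8:
  fixes G :: "('v, 'e) multigraph"
    and ord :: "('e \<times> 'e) set"
    and n :: nat
  assumes "finite_multigraph G"
    and "linear_order_on (edges G) ord"
    and "n \<ge> 1"
  shows "freely_generated_by (color_homology G ord n 0) (proper_colorings G n)
           (\<lambda>f. homology_class G ord n 0 (frag_of (coloring_state G f)))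
       \<and> abelian_rank (color_homology G ord n 0) = enat (chromatic_count G n)
       \<and> (\<forall>k\<ge>1. trivial_group (color_homology G ord n k))"
proof (intro conjI allI impI)
  note G = assms(1) and ord = assms(2)
  note free = color_homology_0_freely_generated[OF G ord, of n]
  show "freely_generated_by (color_homology G ord n 0) (proper_colorings G n)
    (\<lambda>f. homology_class G ord n 0 (frag_of (coloring_state G f)))"
    by (rule free)
  have Z: "comm_group (color_cycle_group G ord n 0)"
    by (rule comm_group_color_cycle_group)
  have "subgroup (color_boundaries G ord n 0) (color_cycle_group G ord n 0)"
    using group.triv_subgroup[OF comm_group.axioms(2)[OF Z]]
    by (simp add: color_boundaries_def color_cycle_group_def chain_group_def)
  then have H: "comm_group (color_homology G ord n 0)"
    unfolding color_homology_def by (rule comm_group.abelian_FactGroup[OF Z])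
  have "proper_colorings G n \<subseteq> nodes G \<rightarrow>\<^sub>E {1..n}"
    by (auto simp: proper_colorings_def)
  moreover have "finite (nodes G \<rightarrow>\<^sub>E {1..n})"
    using G by (intro finite_PiE) (simp_all add: finite_multigraph_def)
  ultimately have "finite (proper_colorings G n)" by (rule finite_subset)
  then show "abelian_rank (color_homology G ord n 0) = enat (chromatic_count G n)"
    unfolding chromatic_count_def by (rule abelian_rank_freely_generated[OF H free])
next
  fix k :: nat assume "k \<ge> 1"
  then obtain j where "k = Suc j" by (cases k) auto
  then have "color_boundaries G ord n k = carrier (color_cycle_group G ord n k)"
    using color_cycles_Suc[OF assms(1,2)] carrier_color_cycle_group[OF assms(1)] by simp
  then show "trivial_group (color_homology G ord n k)"
    unfolding color_homology_def
    by (simp add: trivial_group_Mod_carrier comm_group_color_cycle_group)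
qed

end
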